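(* Let $f_\theta(x,s)=c(s)^\top x$ and let $g_\theta(x,s)=\min_{z\in\mathcal Z}\|x-A_\theta(s)z-b_\theta(s)\|$ with $\mathcal Z=\{z\in\{0,1\}^p: e^\top z=1\}$, where $e\in\mathbb{R}^p$ is the all-ones vector. Then the predictability loss $\ell^{\mathrm p}_\theta(x,s)$ can be reformulated as (i.e. equals the optimal value of) $$\begin{array}{rl}\min & \|\gamma\|\\ \text{s.t.} & \gamma\in\mathbb{R}^n,\ z\in\{0,1\}^p,\ \lambda\in\mathbb{R},\\ & x+\gamma=A_\theta(s)z+b_\theta(s),\\ & e^\top z=1,\\ & c(s)^\top(x+\gamma)-c(s)^\top b_\theta(s)+\lambda\le0,\\ & c(s)^\top A_\theta(s)+\lambda e^\top\ge0,\end{array}$$ where the last inequality is componentwise.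
   Context: Signals $s\in\mathbb{R}^K$ and decisions $x\in\mathbb{R}^n$; $c:\mathbb{R}^K\to\mathbb{R}^n$ is a known function; $A_\theta(s)=A_0+\sum_{k=1}^KA_ks_k\in\mathbb{R}^{n\times p}$ and $b_\theta(s)=b_0+\sum_{k=1}^Kb_ks_k\in\mathbb{R}^n$ with parameter $\theta=(\{A_k,b_k\}_{k=0}^K)$; $\|\cdot\|$ is a norm. Define $$J_\theta(x,s):=f_\theta(x,s)-\min_{y\in\mathbb{R}^n}\{f_\theta(y,s): g_\theta(y,s)\le 0\}.$$ The predictability loss is $$\ell^{\mathrm p}_\theta(x,s):=\min\{\|\gamma\| : \gamma\in\mathbb{R}^n,\ g_\theta(x+\gamma,s)\le 0,\ J_\theta(x+\gamma,s)\le 0\}.$$ *)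

theory Defs
  imports "HOL-Analysis.Analysis"
begin

definition is_norm :: "('v::real_vector \<Rightarrow> real) \<Rightarrow> bool" where
  "is_norm N \<longleftrightarrow>
     (\<forall>v. 0 \<le> N v) \<and>
     (\<forall>v. N v = 0 \<longleftrightarrow> v = 0) \<and>
     (\<forall>a v. N (a *\<^sub>R v) = \<bar>a\<bar> * N v) \<and>
     (\<forall>v w. N (v + w) \<le> N v + N w)"

definition has_min :: "real set \<Rightarrow> bool" where
  "has_min S \<longleftrightarrow> (\<exists>m\<in>S. \<forall>v\<in>S. m \<le> v)"

text \<open>The value of \<open>min_of S\<close> is unspecified unless \<open>has_min S\<close>.\<close>

definition min_of :: "real set \<Rightarrow> real" where
  "min_of S = (LEAST m. m \<in> S)"

lemma has_min_finite: "finite S \<Longrightarrow> S \<noteq> {} \<Longrightarrow> has_min S"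
  unfolding has_min_def using Min_in Min_le by blast

text \<open>
  Signals are in \<open>real ^ 'k\<close>, decisions in \<open>real ^ 'n\<close>. The functions \<open>f\<close> and \<open>g\<close> below
  are taken at a fixed parameter.
\<close>

definition suboptimality ::
  "(real ^ 'n \<Rightarrow> real ^ 'k \<Rightarrow> real) \<Rightarrow> (real ^ 'n \<Rightarrow> real ^ 'k \<Rightarrow> real) \<Rightarrow>
   real ^ 'n \<Rightarrow> real ^ 'k \<Rightarrow> real" where
  "suboptimality f g x s = f x s - min_of {f y s | y. g y s \<le> 0}"

definition predictability_values ::
  "(real ^ 'n \<Rightarrow> real) \<Rightarrow> (real ^ 'n \<Rightarrow> real ^ 'k \<Rightarrow> real) \<Rightarrow>
   (real ^ 'n \<Rightarrow> real ^ 'k \<Rightarrow> real) \<Rightarrow> real ^ 'n \<Rightarrow> real ^ 'k \<Rightarrow> real set" where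
  "predictability_values N f g x s =
     {N \<gamma> | \<gamma>. g (x + \<gamma>) s \<le> 0 \<and> suboptimality f g (x + \<gamma>) s \<le> 0}"

definition predictability_loss ::
  "(real ^ 'n \<Rightarrow> real) \<Rightarrow> (real ^ 'n \<Rightarrow> real ^ 'k \<Rightarrow> real) \<Rightarrow>
   (real ^ 'n \<Rightarrow> real ^ 'k \<Rightarrow> real) \<Rightarrow> real ^ 'n \<Rightarrow> real ^ 'k \<Rightarrow> real" where
  "predictability_loss N f g x s = min_of (predictability_values N f g x s)"

text \<open>
  The index 0 of the affine maps is kept apart: \<open>A_const\<close>, \<open>b_const\<close> are the constant terms
  \<open>A\<^sub>0\<close>, \<open>b\<^sub>0\<close>, and \<open>A_coeff\<close>, \<open>b_coeff\<close> the coefficients of the signal components.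
\<close>

record ('n, 'p, 'k) parameter =
  A_const :: "real ^ ('p::finite) ^ ('n::finite)"
  A_coeff :: "'k \<Rightarrow> real ^ 'p ^ 'n"
  b_const :: "real ^ 'n"
  b_coeff :: "'k \<Rightarrow> real ^ 'n"

definition A_at :: "('n::finite, 'p::finite, 'k::finite) parameter \<Rightarrow> real ^ 'k \<Rightarrow> real ^ 'p ^ 'n" where
  "A_at \<theta> s = A_const \<theta> + (\<Sum>k\<in>UNIV. (s $ k) *\<^sub>R A_coeff \<theta> k)"

definition b_at :: "('n::finite, 'p::finite, 'k::finite) parameter \<Rightarrow> real ^ 'k \<Rightarrow> real ^ 'n" where
  "b_at \<theta> s = b_const \<theta> + (\<Sum>k\<in>UNIV. (s $ k) *\<^sub>R b_coeff \<theta> k)"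

definition binary_vectors :: "(real ^ 'p) set" where
  "binary_vectors = {z. \<forall>j. z $ j \<in> {0, 1}}"

definition ones :: "real ^ 'p" where
  "ones = (\<chi> j. 1)"

definition selectors :: "(real ^ 'p) set" where
  "selectors = {z \<in> binary_vectors. ones \<bullet> z = 1}"

definition linear_objective ::
  "(real ^ 'k \<Rightarrow> real ^ 'n) \<Rightarrow> real ^ 'n \<Rightarrow> real ^ 'k \<Rightarrow> real" where
  "linear_objective c x s = c s \<bullet> x"

definition selection_constraint ::
  "(real ^ 'n \<Rightarrow> real) \<Rightarrow> ('n::finite, 'p::finite, 'k::finite) parameter \<Rightarrow>
   real ^ 'n \<Rightarrow> real ^ 'k \<Rightarrow> real" where
  "selection_constraint N \<theta> x s =
     min_of {N (x - A_at \<theta> s *v z - b_at \<theta> s) | z. z \<in> selectors}"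

definition reformulation_values ::
  "(real ^ 'n \<Rightarrow> real) \<Rightarrow> (real ^ 'k \<Rightarrow> real ^ 'n) \<Rightarrow>
   ('n::finite, 'p::finite, 'k::finite) parameter \<Rightarrow> real ^ 'n \<Rightarrow> real ^ 'k \<Rightarrow> real set" where
  "reformulation_values N c \<theta> x s =
     {N \<gamma> | \<gamma> z l.
        z \<in> binary_vectors \<and>
        x + \<gamma> = A_at \<theta> s *v z + b_at \<theta> s \<and>
        ones \<bullet> z = 1 \<and>
        c s \<bullet> (x + \<gamma>) - c s \<bullet> b_at \<theta> s + l \<le> 0 \<and>
        (\<forall>j. 0 \<le> (c s v* A_at \<theta> s + l *\<^sub>R ones) $ j)}"

text \<open>The minimum in \<open>selection_constraint\<close> is always attained.\<close>

lemma finite_selectors: "finite (selectors :: (real ^ 'p) set)"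
proof -
  have "(selectors :: (real ^ 'p) set) \<subseteq> vec_lambda ` (UNIV \<rightarrow>\<^sub>E {0, 1})"
  proof
    fix z :: "real ^ 'p"
    assume "z \<in> selectors"
    then have "(\<lambda>j. z $ j) \<in> UNIV \<rightarrow>\<^sub>E {0, 1}"
      by (auto simp: selectors_def binary_vectors_def PiE_UNIV_domain)
    then show "z \<in> vec_lambda ` (UNIV \<rightarrow>\<^sub>E {0, 1})"
      by (metis image_eqI vec_nth_inverse)
  qed
  moreover have "finite (vec_lambda ` ((UNIV :: 'p set) \<rightarrow>\<^sub>E {0, 1 :: real}))"
    by (intro finite_imageI finite_PiE) simp_all
  ultimately show ?thesis
    by (rule finite_subset)
qed

lemma selectors_nonempty: "(selectors :: (real ^ 'p) set) \<noteq> {}"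
proof -
  have "axis i 1 \<in> (selectors :: (real ^ 'p) set)" for i :: 'p
    by (simp add: selectors_def binary_vectors_def ones_def inner_axis) (simp add: axis_def)
  then show ?thesis by blast
qed

lemma has_min_selection:
  "has_min {N (x - A_at \<theta> s *v z - b_at \<theta> s) | z. z \<in> selectors}"
  by (rule has_min_finite) (simp_all add: Setcompr_eq_image finite_selectors selectors_nonempty)

end

theory Submission
  imports Defs
begin

text \<open>
  A selector is a standard basis vector, so the constraint \<open>g y s \<le> 0\<close> says that \<open>y\<close> is one of
  the finitely many points \<open>A z + b\<close> with \<open>z\<close> a selector: the minimum defining \<open>g\<close> is attained,
  and a norm that is at most zero vanishes only at zero. Both minimisation problems are therefore
  over finite sets.

  The condition that a feasible point \<open>y\<close> is optimal reads \<open>c \<bullet> y - c \<bullet> b \<le> (c A) \<bullet> z\<close> for all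
  selectors \<open>z\<close>. The right-hand side is minimised over the vertices of the simplex, and the dual
  of that linear program has a single variable \<open>l\<close>: it maximises \<open>- l\<close> subject to
  \<open>c A + l e \<ge> 0\<close>. Hence optimality of \<open>y\<close> is equivalent to the existence of a dual feasible \<open>l\<close>
  with \<open>c \<bullet> y - c \<bullet> b \<le> - l\<close> (lemma \<open>dual_certificate\<close>). It follows that the two problems
  minimise over the same set of values (lemma \<open>predictability_eq_reformulation\<close>), not merely that
  their minima agree.
\<close>

lemma
  assumes "has_min S"
  shows min_of_in: "min_of S \<in> S" and min_of_le: "v \<in> S \<Longrightarrow> min_of S \<le> v"
proof -
  obtain m where "m \<in> S" "\<forall>v\<in>S. m \<le> v"
    using assms unfolding has_min_def by blast
  then have "min_of S = m"
    unfolding min_of_def by (intro Least_equality) auto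
  then show "min_of S \<in> S" "v \<in> S \<Longrightarrow> min_of S \<le> v"
    using \<open>m \<in> S\<close> \<open>\<forall>v\<in>S. m \<le> v\<close> by auto
qed

lemma min_of_le_iff: "has_min S \<Longrightarrow> min_of S \<le> r \<longleftrightarrow> (\<exists>v\<in>S. v \<le> r)"
  using min_of_in min_of_le order_trans by blast

lemma le_min_of_iff: "has_min S \<Longrightarrow> r \<le> min_of S \<longleftrightarrow> (\<forall>v\<in>S. r \<le> v)"
  using min_of_in min_of_le order_trans by blast

lemma selectors_eq_range_axis: "(selectors :: (real ^ 'p) set) = range (\<lambda>j. axis j 1)"
proof (intro equalityI subsetI)
  fix z :: "real ^ 'p"
  assume z: "z \<in> selectors"
  then have binary: "z $ j = 0 \<or> z $ j = 1" for j
    by (auto simp: selectors_def binary_vectors_def)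
  \<comment> \<open>The entries sum to 1, so the set of positions with entry 1 is a singleton.\<close>
  have "real (card {j. z $ j = 1}) = (\<Sum>j\<in>UNIV. if z $ j = 1 then 1 else 0)"
    by (simp add: sum.If_cases)
  also have "\<dots> = (\<Sum>j\<in>UNIV. z $ j)"
    using binary by (intro sum.cong) auto
  also have "\<dots> = 1"
    using z by (simp add: selectors_def ones_def inner_vec_def)
  finally have "card {j. z $ j = 1} = 1"
    by simp
  then obtain i where "{j. z $ j = 1} = {i}"
    by (auto simp: card_1_singleton_iff)
  then have "z = axis i 1"
    using binary by (auto simp: vec_eq_iff axis_def)
  then show "z \<in> range (\<lambda>j. axis j 1)"
    by blast
next
  fix z :: "real ^ 'p"
  assume "z \<in> range (\<lambda>j. axis j 1)"
  then obtain i where "z = axis i 1"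
    by blast
  then show "z \<in> selectors"
    by (simp add: selectors_def binary_vectors_def ones_def inner_axis) (simp add: axis_def)
qed

text \<open>
  Linear programming duality on the simplex, where it needs no separation argument: the minimum
  of \<open>q \<bullet> z\<close> is the least entry of \<open>q\<close>, and \<open>l = - t\<close> is a certificate for every lower bound \<open>t\<close>.
\<close>

lemma dual_certificate:
  fixes q :: "real ^ 'p"
  shows "(\<exists>l. t + l \<le> 0 \<and> (\<forall>j. 0 \<le> (q + l *\<^sub>R ones) $ j)) \<longleftrightarrow> (\<forall>z\<in>selectors. t \<le> q \<bullet> z)"
proof
  assume "\<exists>l. t + l \<le> 0 \<and> (\<forall>j. 0 \<le> (q + l *\<^sub>R ones) $ j)"
  then obtain l where l: "t + l \<le> 0" "\<And>j. 0 \<le> q $ j + l"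
    by (auto simp: ones_def)
  have "t \<le> q $ j" for j
    using l(1) l(2)[of j] by linarith
  then show "\<forall>z\<in>selectors. t \<le> q \<bullet> z"
    by (simp add: selectors_eq_range_axis inner_axis)
next
  assume "\<forall>z\<in>selectors. t \<le> q \<bullet> z"
  then have "\<forall>j. 0 \<le> (q + (- t) *\<^sub>R ones) $ j"
    by (simp add: selectors_eq_range_axis inner_axis ones_def)
  then show "\<exists>l. t + l \<le> 0 \<and> (\<forall>j. 0 \<le> (q + l *\<^sub>R ones) $ j)"
    by (intro exI[of _ "- t"]) simp
qed

definition selected_points ::
  "('n::finite, 'p::finite, 'k::finite) parameter \<Rightarrow> real ^ 'k \<Rightarrow> (real ^ 'n) set" where
  "selected_points \<theta> s = (\<lambda>z. A_at \<theta> s *v z + b_at \<theta> s) ` selectors"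

lemma finite_selected_points: "finite (selected_points \<theta> s)"
  by (simp add: selected_points_def finite_selectors)

lemma selected_points_nonempty: "selected_points \<theta> s \<noteq> {}"
  by (simp add: selected_points_def selectors_nonempty)

lemma selection_constraint_le_0_iff:
  assumes "is_norm N"
  shows "selection_constraint N \<theta> y s \<le> 0 \<longleftrightarrow> y \<in> selected_points \<theta> s"
proof -
  have N: "N v \<le> 0 \<longleftrightarrow> v = 0" for v
    using assms unfolding is_norm_def by (metis order_antisym order_refl)
  have "selection_constraint N \<theta> y s \<le> 0 \<longleftrightarrow>
      (\<exists>z\<in>selectors. N (y - A_at \<theta> s *v z - b_at \<theta> s) \<le> 0)"
    unfolding selection_constraint_def min_of_le_iff[OF has_min_selection] by blast
  also have "\<dots> \<longleftrightarrow> y \<in> selected_points \<theta> s"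
    by (auto simp: N selected_points_def diff_diff_eq)
  finally show ?thesis .
qed

lemma has_min_objective:
  assumes "is_norm N"
  shows "has_min {f y s | y. selection_constraint N \<theta> y s \<le> 0}"
  using finite_selected_points[of \<theta> s] selected_points_nonempty[of \<theta> s]
  by (auto simp: selection_constraint_le_0_iff[OF assms] Setcompr_eq_image intro!: has_min_finite)

lemma suboptimality_le_0_iff:
  assumes "is_norm N"
  shows "suboptimality f (selection_constraint N \<theta>) y s \<le> 0 \<longleftrightarrow>
    (\<forall>w\<in>selected_points \<theta> s. f y s \<le> f w s)"
  using le_min_of_iff[OF has_min_objective[OF assms, of f s \<theta>], of "f y s"]
  by (auto simp: suboptimality_def selection_constraint_le_0_iff[OF assms])

lemma predictability_values_eq:
  assumes "is_norm N"
  shows "predictability_values N f (selection_constraint N \<theta>) x s =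
    {N \<gamma> | \<gamma>. x + \<gamma> \<in> selected_points \<theta> s \<and>
      (\<forall>w\<in>selected_points \<theta> s. f (x + \<gamma>) s \<le> f w s)}"
  by (simp add: predictability_values_def selection_constraint_le_0_iff[OF assms]
      suboptimality_le_0_iff[OF assms])

text \<open>Some feasible point has least objective value because there are only finitely many.\<close>

lemma has_min_predictability_values:
  fixes f :: "real ^ 'n \<Rightarrow> real ^ 'k \<Rightarrow> real"
    and \<theta> :: "('n::finite, 'p::finite, 'k::finite) parameter"
  assumes "is_norm N"
  shows "has_min (predictability_values N f (selection_constraint N \<theta>) x s)"
proof (rule has_min_finite)
  have "predictability_values N f (selection_constraint N \<theta>) x s \<subseteq>
      (\<lambda>y. N (y - x)) ` selected_points \<theta> s"
    unfolding predictability_values_eq[OF assms] by (force intro!: image_eqI)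
  then show "finite (predictability_values N f (selection_constraint N \<theta>) x s)"
    by (rule finite_subset) (simp add: finite_selected_points)
next
  obtain y where y: "y \<in> selected_points \<theta> s" "\<And>w. w \<in> selected_points \<theta> s \<Longrightarrow> f y s \<le> f w s"
    using ex_is_arg_min_if_finite[OF finite_selected_points selected_points_nonempty, of "\<lambda>y. f y s"]
    by (metis is_arg_min_linorder)
  then have "N (y - x) \<in> predictability_values N f (selection_constraint N \<theta>) x s"
    unfolding predictability_values_eq[OF assms] by (auto intro!: exI[of _ "y - x"])
  then show "predictability_values N f (selection_constraint N \<theta>) x s \<noteq> {}"
    by blast
qed

text \<open>
  By bilinearity, \<open>c \<bullet> (A z + b) = (c A) \<bullet> z + c \<bullet> b\<close>; comparing objective values thus means
  bounding \<open>(c A) \<bullet> z\<close> from below over the selectors, which is what a dual variable certifies.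
\<close>

lemma linear_objective_minimal_iff:
  "(\<forall>w\<in>selected_points \<theta> s. linear_objective c y s \<le> linear_objective c w s) \<longleftrightarrow>
    (\<exists>l. c s \<bullet> y - c s \<bullet> b_at \<theta> s + l \<le> 0 \<and> (\<forall>j. 0 \<le> (c s v* A_at \<theta> s + l *\<^sub>R ones) $ j))"
  unfolding dual_certificate
  by (simp add: selected_points_def linear_objective_def dot_lmul_matrix inner_add_right
      diff_le_eq)

lemma predictability_eq_reformulation:
  assumes "is_norm N"
  shows "predictability_values N (linear_objective c) (selection_constraint N \<theta>) x s =
    reformulation_values N c \<theta> x s"
  unfolding predictability_values_eq[OF assms] linear_objective_minimal_iff reformulation_values_def
  unfolding selected_points_def selectors_def image_iff by blast

theorem propositionD1:
  fixes N :: "real ^ 'n \<Rightarrow> real"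
    and c :: "real ^ 'k \<Rightarrow> real ^ 'n"
    and \<theta> :: "('n::finite, 'p::finite, 'k::finite) parameter"
    and x :: "real ^ 'n"
    and s :: "real ^ 'k"
  assumes "is_norm N"
  defines "f \<equiv> linear_objective c"
    and "g \<equiv> selection_constraint N \<theta>"
  shows "has_min {f y s | y. g y s \<le> 0}
    \<and> has_min (predictability_values N f g x s)
    \<and> has_min (reformulation_values N c \<theta> x s)
    \<and> predictability_loss N f g x s = min_of (reformulation_values N c \<theta> x s)"
  using has_min_objective[OF assms(1), of f s \<theta>]
    has_min_predictability_values[OF assms(1), of f \<theta> x s]
  by (simp add: f_def g_def predictability_loss_def
      flip: predictability_eq_reformulation[OF assms(1)])

end
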